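(* Let $Z$ be a Hausdorff topological space with no isolated points and let $f_1,\dots,f_N$ be continuous maps $Z\to Z$ such that there exists a weakly mixing map $g\colon Z\to Z$ with $g\circ f_i=f_i\circ g$ for $i=1,\dots,N$. Then the family $d\text{-}\mathcal{N}_f$ of supersets of the disjoint return sets of $f_1,\dots,f_N$ is a filter.
   Context: $\mathbb{N}=\{0,1,2,\dots\}$. A family $\mathcal{A}\subset\mathcal{P}(\mathbb{N})$ is a Furstenberg family if (i) every $A\in\mathcal{A}$ is infinite, and (ii) $A\in\mathcal{A}$ and $A\subset B\subset\mathbb{N}$ imply $B\in\mathcal{A}$. It is a filter if, moreover, (iii) $A,B\in\mathcal{A}$ implies $A\cap B\in\mathcal{A}$. Write $f:=f_1\times\dots\times f_N$. For non-empty open sets $U_0,U_1,\dots,U_N\subset Z$ and $U:=U_1\times\dots\times U_N\subset Z^N$, the disjoint return set is $$d\text{-}\mathcal{N}_f(U_0,U):=\Big\{m\in\mathbb{N}: U_0\cap \bigcap_{i=1}^N f_i^{-m}(U_i)\neq\emptyset\Big\},$$ where $f_i^{-m}(\cdot)$ denotes the preimage under the $m$-th iterate of $f_i$. The family of supersets of the disjoint return sets is $$d\text{-}\mathcal{N}_f:=\{A\subset\mathbb{N}: d\text{-}\mathcal{N}_f(U_0,U)\subset A\text{ for some non-empty open } U_0,U_1,\dots,U_N\subset Z,\ U=U_1\times\dots\times U_N\}.$$ A continuous map $h\colon Y\to Y$ on a topological space $Y$ is (topologically) transitive if for all non-empty open $U,V\subset Y$ there is $m\in\mathbb{N}$ with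 $h^m(U)\cap V\neq\emptyset$. A continuous map $g\colon Z\to Z$ is weakly mixing if $g\times g$ is transitive on $Z\times Z$.
   Formalization: The maps f_1,…,f_N are additionally assumed disjoint transitive (every disjoint return set is non-empty); without this the claim fails, e.g. for N=1, f_1 the identity and g the shift on Cantor space, since the empty set then belongs to the family. *)

theory Defs
  imports "HOL-Analysis.Analysis"
begin

definition furstenberg_family :: "nat set set \<Rightarrow> bool" where
  "furstenberg_family \<A> \<longleftrightarrow>
     (\<forall>A\<in>\<A>. infinite A) \<and> (\<forall>A B. A \<in> \<A> \<longrightarrow> A \<subseteq> B \<longrightarrow> B \<in> \<A>)"

definition filter_family :: "nat set set \<Rightarrow> bool" where
  "filter_family \<A> \<longleftrightarrow>
     furstenberg_family \<A> \<and> (\<forall>A\<in>\<A>. \<forall>B\<in>\<A>. A \<inter> B \<in> \<A>)"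

definition transitive_map :: "('a::topological_space \<Rightarrow> 'a) \<Rightarrow> bool" where
  "transitive_map h \<longleftrightarrow> continuous_on UNIV h \<and>
     (\<forall>U V. open U \<longrightarrow> U \<noteq> {} \<longrightarrow> open V \<longrightarrow> V \<noteq> {} \<longrightarrow>
        (\<exists>m. (h ^^ m) ` U \<inter> V \<noteq> {}))"

definition weakly_mixing :: "('a::topological_space \<Rightarrow> 'a) \<Rightarrow> bool" where
  "weakly_mixing g \<longleftrightarrow> continuous_on UNIV g \<and> transitive_map (map_prod g g)"

text \<open>The maps \<open>f\<^sub>1, \<dots>, f\<^sub>N\<close> are the values of \<open>f\<close> on \<open>{1..N}\<close>, and the open box
  \<open>U\<^sub>1 \<times> \<dots> \<times> U\<^sub>N\<close> is represented by its factors \<open>U 1, \<dots>, U N\<close>; values of \<open>f\<close> and \<open>U\<close>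
  outside \<open>{1..N}\<close> play no role.\<close>

definition d_return_set ::
    "nat \<Rightarrow> (nat \<Rightarrow> 'a \<Rightarrow> 'a) \<Rightarrow> 'a set \<Rightarrow> (nat \<Rightarrow> 'a set) \<Rightarrow> nat set" where
  "d_return_set N f U0 U = {m. U0 \<inter> (\<Inter>i\<in>{1..N}. (f i ^^ m) -` U i) \<noteq> {}}"

definition d_return_family ::
    "nat \<Rightarrow> (nat \<Rightarrow> 'a::topological_space \<Rightarrow> 'a) \<Rightarrow> nat set set" where
  "d_return_family N f =
     {A. \<exists>U0 U. open U0 \<and> U0 \<noteq> {} \<and> (\<forall>i\<in>{1..N}. open (U i) \<and> U i \<noteq> {}) \<and>
                d_return_set N f U0 U \<subseteq> A}"

text \<open>Disjoint transitivity of \<open>f\<^sub>1, \<dots>, f\<^sub>N\<close>: no disjoint return set is empty. If it fails,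
  \<open>d_return_family N f\<close> contains \<open>{}\<close>, hence every set of natural numbers, and is not a
  Furstenberg family. A commuting weakly mixing map does not exclude this: take \<open>N = 1\<close>,
  \<open>f\<^sub>1 = id\<close>, and disjoint \<open>U\<^sub>0\<close>, \<open>U\<^sub>1\<close>.\<close>

definition d_transitive :: "nat \<Rightarrow> (nat \<Rightarrow> 'a::topological_space \<Rightarrow> 'a) \<Rightarrow> bool" where
  "d_transitive N f \<longleftrightarrow>
     (\<forall>U0 U. open U0 \<longrightarrow> U0 \<noteq> {} \<longrightarrow> (\<forall>i\<in>{1..N}. open (U i) \<and> U i \<noteq> {}) \<longrightarrow>
        d_return_set N f U0 U \<noteq> {})"

end

theory Submission
  imports Defs
begin

text \<open>Put \<open>N\<^sub>g(A, B) = {k. A \<inter> g\<^sup>-\<^sup>k B \<noteq> {}}\<close>. As \<open>g \<times> g\<close> is transitive, there is \<open>n\<close> for which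
  \<open>E = A \<inter> g\<^sup>-\<^sup>n C\<close> and \<open>F = B \<inter> g\<^sup>-\<^sup>n D\<close> are both non-empty, and then
  \<open>N\<^sub>g(E, F) \<subseteq> N\<^sub>g(A, B) \<inter> N\<^sub>g(C, D)\<close>; hence any finitely many of the sets \<open>N\<^sub>g(A, B)\<close> have a common
  element. Given two boxes, a \<open>k\<close> common to all factors makes the sets \<open>U\<^sub>i \<inter> g\<^sup>-\<^sup>k V\<^sub>i\<close> non-empty, and
  since \<open>g\<close> commutes with the \<open>f\<^sub>i\<close>, every return of the box they form is a return of both \<open>U\<close> and
  \<open>V\<close>. For infinitude, any finite set of times can be removed from a return set by shrinking
  \<open>U\<^sub>0\<close> and \<open>U\<^sub>1\<close>, whereas disjoint transitivity says that something always remains.\<close>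

lemma continuous_on_funpow_UNIV:
  fixes h :: "'a::topological_space \<Rightarrow> 'a"
  assumes "continuous_on UNIV h"
  shows "continuous_on UNIV (h ^^ n)"
proof (induction n)
  case 0
  then show ?case by (simp add: id_def)
next
  case (Suc n)
  have "continuous_on UNIV (h \<circ> (h ^^ n))"
    using Suc continuous_on_subset[OF assms] by (rule continuous_on_compose) simp
  then show ?case by simp
qed

lemma open_vimage_funpow:
  fixes h :: "'a::topological_space \<Rightarrow> 'a"
  assumes "continuous_on UNIV h" "open U"
  shows "open ((h ^^ n) -` U)"
  using continuous_on_funpow_UNIV[OF assms(1)] assms(2) by (rule open_vimage[rotated])

text \<open>Iterating \<open>h\<close> first and then \<open>g\<close> takes two inductions. With
  \<open>h\<close> equal to \<open>g\<close>, it also says that powers of \<open>g\<close> commute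
  with one another.\<close>

lemma funpow_commute:
  assumes "g \<circ> h = h \<circ> g"
  shows "(g ^^ k) ((h ^^ m) x) = (h ^^ m) ((g ^^ k) x)"
proof -
  have 1: "g ((h ^^ m) y) = (h ^^ m) (g y)" for m y
    by (induction m) (use assms in \<open>auto simp: fun_eq_iff\<close>)
  show ?thesis
    by (induction k) (auto simp: 1)
qed

text \<open>Powers of \<open>map_prod g g\<close> act coordinatewise, so one return from the box
  \<open>A \<times> B\<close> to \<open>C \<times> D\<close> is a simultaneous return in both
  coordinates.\<close>

lemma weakly_mixing_common_return:
  fixes g :: "'a::topological_space \<Rightarrow> 'a"
  assumes "weakly_mixing g"
    and "open A" "A \<noteq> {}" "open B" "B \<noteq> {}" "open C" "C \<noteq> {}" "open D" "D \<noteq> {}"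
  obtains n where "A \<inter> (g ^^ n) -` C \<noteq> {}" "B \<inter> (g ^^ n) -` D \<noteq> {}"
proof -
  have pow: "(map_prod g g ^^ n) (x, y) = ((g ^^ n) x, (g ^^ n) y)" for n x y
    by (induction n) auto
  have "open (A \<times> B)" "A \<times> B \<noteq> {}" "open (C \<times> D)" "C \<times> D \<noteq> {}"
    using assms(2-) by (simp_all add: open_Times)
  moreover have "\<forall>U V. open U \<longrightarrow> U \<noteq> {} \<longrightarrow> open V \<longrightarrow> V \<noteq> {} \<longrightarrow>
      (\<exists>m. (map_prod g g ^^ m) ` U \<inter> V \<noteq> {})"
    using assms(1) unfolding weakly_mixing_def transitive_map_def by (elim conjE)
  ultimately obtain n where "(map_prod g g ^^ n) ` (A \<times> B) \<inter> (C \<times> D) \<noteq> {}"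
    by metis
  then have "A \<inter> (g ^^ n) -` C \<noteq> {}" "B \<inter> (g ^^ n) -` D \<noteq> {}"
    by (auto simp: pow)
  then show ?thesis by (rule that)
qed

lemma weakly_mixing_common_return_finite:
  fixes g :: "'a::topological_space \<Rightarrow> 'a"
  assumes wm: "weakly_mixing g" and "finite I"
    and "\<And>i. i \<in> I \<Longrightarrow> open (A i) \<and> A i \<noteq> {} \<and> open (B i) \<and> B i \<noteq> {}"
  obtains k where "\<forall>i\<in>I. A i \<inter> (g ^^ k) -` B i \<noteq> {}"
proof -
  have cont: "continuous_on UNIV g"
    using wm by (simp add: weakly_mixing_def)
  \<comment> \<open>A common \<open>k\<close> for \<open>I\<close> could not be combined with a
    further index. The induction therefore carries a single pair \<open>E\<close>, \<open>F\<close>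
    all of whose return times serve every index at once.\<close>
  have "\<exists>E F. open E \<and> E \<noteq> {} \<and> open F \<and> F \<noteq> {} \<and>
      (\<forall>k. E \<inter> (g ^^ k) -` F \<noteq> {} \<longrightarrow> (\<forall>i\<in>I. A i \<inter> (g ^^ k) -` B i \<noteq> {}))"
    using assms(2,3)
  proof (induction I)
    case empty
    show ?case by (rule exI[of _ UNIV], rule exI[of _ UNIV]) auto
  next
    case (insert j I)
    have "open (A i) \<and> A i \<noteq> {} \<and> open (B i) \<and> B i \<noteq> {}" if "i \<in> I" for i
      using insert.prems that by simp
    from insert.IH[OF this] obtain E F where EF: "open E" "E \<noteq> {}" "open F" "F \<noteq> {}"
      and ret: "\<And>k. E \<inter> (g ^^ k) -` F \<noteq> {} \<Longrightarrow> \<forall>i\<in>I. A i \<inter> (g ^^ k) -` B i \<noteq> {}"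
      by auto
    have j: "open (A j)" "A j \<noteq> {}" "open (B j)" "B j \<noteq> {}"
      using insert.prems by auto
    obtain n where n: "E \<inter> (g ^^ n) -` A j \<noteq> {}" "F \<inter> (g ^^ n) -` B j \<noteq> {}"
      by (rule weakly_mixing_common_return[OF wm EF j])
    have "\<forall>i\<in>insert j I. A i \<inter> (g ^^ k) -` B i \<noteq> {}"
      if k: "(E \<inter> (g ^^ n) -` A j) \<inter> (g ^^ k) -` (F \<inter> (g ^^ n) -` B j) \<noteq> {}" for k
    proof -
      \<comment> \<open>The point \<open>x\<close> witnesses the return from \<open>E\<close> to
        \<open>F\<close>, and its image under \<open>g ^^ n\<close> the return from
        \<open>A j\<close> to \<open>B j\<close> at the same time \<open>k\<close>.\<close>
      obtain x where x: "x \<in> E" "(g ^^ n) x \<in> A j" "(g ^^ k) x \<in> F" "(g ^^ n) ((g ^^ k) x) \<in> B j"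
        using k by auto
      have "(g ^^ k) ((g ^^ n) x) \<in> B j"
        using x(4) by (simp add: funpow_commute)
      then have "A j \<inter> (g ^^ k) -` B j \<noteq> {}"
        using x(2) by auto
      moreover have "E \<inter> (g ^^ k) -` F \<noteq> {}"
        using x by auto
      ultimately show ?thesis using ret by auto
    qed
    moreover have "open (E \<inter> (g ^^ n) -` A j)" "open (F \<inter> (g ^^ n) -` B j)"
      using EF j open_vimage_funpow[OF cont] by (auto intro: open_Int)
    ultimately show ?case using n by blast
  qed
  then obtain E F where EF: "open E" "E \<noteq> {}" "open F" "F \<noteq> {}"
    and ret: "\<And>k. E \<inter> (g ^^ k) -` F \<noteq> {} \<Longrightarrow> \<forall>i\<in>I. A i \<inter> (g ^^ k) -` B i \<noteq> {}"
    by blast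
  \<comment> \<open>Both coordinates get the same pair \<open>E\<close>, \<open>F\<close>, which
    gives an ordinary return of \<open>g\<close>.\<close>
  obtain k where "E \<inter> (g ^^ k) -` F \<noteq> {}"
    by (rule weakly_mixing_common_return[OF wm EF(1,2) EF(1,2) EF(3,4) EF(3,4)])
  from that[OF ret[OF this]] show ?thesis .
qed

text \<open>Times are removed one by one. To remove \<open>m\<close>, pick \<open>x\<close> in the
  first set and \<open>y \<noteq> (h ^^ m) x\<close> in the second, separate
  \<open>(h ^^ m) x\<close> from \<open>y\<close>, and shrink both sets accordingly. Times removed
  earlier stay removed under shrinking.\<close>

lemma open_avoid_finite_returns:
  fixes h :: "'a::{t2_space, perfect_space} \<Rightarrow> 'a"
  assumes cont: "continuous_on UNIV h" and "finite M"
    and "open U" "U \<noteq> {}" "open V" "V \<noteq> {}"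
  obtains U' V' where "open U'" "U' \<noteq> {}" "U' \<subseteq> U" "open V'" "V' \<noteq> {}" "V' \<subseteq> V"
    "\<And>m. m \<in> M \<Longrightarrow> U' \<inter> (h ^^ m) -` V' = {}"
proof -
  have "\<exists>U' V'. open U' \<and> U' \<noteq> {} \<and> U' \<subseteq> U \<and> open V' \<and> V' \<noteq> {} \<and> V' \<subseteq> V \<and>
      (\<forall>m\<in>M. U' \<inter> (h ^^ m) -` V' = {})"
    using assms(2)
  proof (induction M)
    case empty
    then show ?case using assms by auto
  next
    case (insert m M)
    then obtain U' V' where UV: "open U'" "U' \<noteq> {}" "U' \<subseteq> U" "open V'" "V' \<noteq> {}" "V' \<subseteq> V"
      and avoid: "\<forall>m\<in>M. U' \<inter> (h ^^ m) -` V' = {}" by blast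
    obtain x where x: "x \<in> U'" using UV by auto
    \<comment> \<open>Without isolated points, a non-empty open set has a point other than
      \<open>(h ^^ m) x\<close>.\<close>
    have "V' \<noteq> {(h ^^ m) x}"
      using UV(4) not_open_singleton by metis
    then obtain y where y: "y \<in> V'" "(h ^^ m) x \<noteq> y"
      using UV(5) by auto
    obtain S T where ST: "open S" "open T" "(h ^^ m) x \<in> S" "y \<in> T" "S \<inter> T = {}"
      using hausdorff[OF y(2)] by blast
    have "open (U' \<inter> (h ^^ m) -` S)" "open (V' \<inter> T)"
      using UV ST open_vimage_funpow[OF cont] by auto
    moreover have "U' \<inter> (h ^^ m) -` S \<noteq> {}" "V' \<inter> T \<noteq> {}"
      using x y ST by auto
    moreover have "\<forall>l\<in>insert m M. (U' \<inter> (h ^^ m) -` S) \<inter> (h ^^ l) -` (V' \<inter> T) = {}"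
      using avoid ST(5) by blast
    moreover have "U' \<inter> (h ^^ m) -` S \<subseteq> U" "V' \<inter> T \<subseteq> V"
      using UV(3,6) by auto
    ultimately show ?case by meson
  qed
  then obtain U' V' where "open U'" "U' \<noteq> {}" "U' \<subseteq> U" "open V'" "V' \<noteq> {}" "V' \<subseteq> V"
    "\<forall>m\<in>M. U' \<inter> (h ^^ m) -` V' = {}"
    by (elim exE conjE)
  then show ?thesis by (intro that[of U' V']) simp_all
qed

lemma d_return_set_infinite:
  fixes f :: "nat \<Rightarrow> 'a::{t2_space, perfect_space} \<Rightarrow> 'a"
  assumes "N \<ge> 1" "continuous_on UNIV (f 1)" "d_transitive N f"
    and U: "open U0" "U0 \<noteq> {}" "\<forall>i\<in>{1..N}. open (U i) \<and> U i \<noteq> {}"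
  shows "infinite (d_return_set N f U0 U)"
proof
  assume "finite (d_return_set N f U0 U)"
  moreover have 1: "1 \<in> {1..N}" using assms(1) by simp
  ultimately obtain U0' V where V: "open U0'" "U0' \<noteq> {}" "U0' \<subseteq> U0" "open V" "V \<noteq> {}" "V \<subseteq> U 1"
    and avoid: "\<And>m. m \<in> d_return_set N f U0 U \<Longrightarrow> U0' \<inter> (f 1 ^^ m) -` V = {}"
    using open_avoid_finite_returns[OF assms(2), of _ U0 "U 1"] U by metis
  \<comment> \<open>A return of the shrunken box is also one of the original box, hence among the
    very times that \<open>U0'\<close> and \<open>V\<close> were chosen to avoid.\<close>
  have "d_return_set N f U0' (U(1 := V)) \<noteq> {}"
    using assms(3) U(3) V unfolding d_transitive_def by simp
  then obtain m x where x: "x \<in> U0'" "\<forall>i\<in>{1..N}. (f i ^^ m) x \<in> (U(1 := V)) i"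
    unfolding d_return_set_def by blast
  have "(f i ^^ m) x \<in> U i" if "i \<in> {1..N}" for i
    using bspec[OF x(2) that] V(6) by (auto split: if_splits)
  then have "m \<in> d_return_set N f U0 U"
    using x(1) V(3) unfolding d_return_set_def by auto
  from avoid[OF this] show False
    using x(1) bspec[OF x(2) 1] by auto
qed

lemma d_return_set_Int:
  fixes f :: "nat \<Rightarrow> 'a::topological_space \<Rightarrow> 'a"
  assumes wm: "weakly_mixing g" and comm: "\<forall>i\<in>{1..N}. g \<circ> f i = f i \<circ> g"
    and U: "open U0" "U0 \<noteq> {}" "\<forall>i\<in>{1..N}. open (U i) \<and> U i \<noteq> {}"
    and V: "open V0" "V0 \<noteq> {}" "\<forall>i\<in>{1..N}. open (V i) \<and> V i \<noteq> {}"
  obtains W0 W where "open W0" "W0 \<noteq> {}" "\<forall>i\<in>{1..N}. open (W i) \<and> W i \<noteq> {}"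
    "d_return_set N f W0 W \<subseteq> d_return_set N f U0 U \<inter> d_return_set N f V0 V"
proof -
  have cont: "continuous_on UNIV g"
    using wm by (simp add: weakly_mixing_def)
  \<comment> \<open>The factors start at index 1, so index 0 is free to hold \<open>U0\<close> and
    \<open>V0\<close>; one \<open>k\<close> then serves them together with all factors.\<close>
  have "open ((U(0 := U0)) i) \<and> (U(0 := U0)) i \<noteq> {} \<and> open ((V(0 := V0)) i) \<and> (V(0 := V0)) i \<noteq> {}"
    if "i \<in> {0..N}" for i
    using U V that by (cases "i = 0") simp_all
  from weakly_mixing_common_return_finite[OF wm finite_atLeastAtMost this]
  obtain k where k: "\<forall>i\<in>{0..N}. (U(0 := U0)) i \<inter> (g ^^ k) -` (V(0 := V0)) i \<noteq> {}" .
  define W where "W i = U i \<inter> (g ^^ k) -` V i" for i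
  show ?thesis
  proof (rule that)
    show "open (U0 \<inter> (g ^^ k) -` V0)"
      using U V open_vimage_funpow[OF cont] by auto
    show "U0 \<inter> (g ^^ k) -` V0 \<noteq> {}"
      using bspec[OF k, of 0] by simp
    show "\<forall>i\<in>{1..N}. open (W i) \<and> W i \<noteq> {}"
    proof
      fix i assume i: "i \<in> {1..N}"
      then show "open (W i) \<and> W i \<noteq> {}"
        using bspec[OF k, of i] U V open_vimage_funpow[OF cont] by (auto simp: W_def)
    qed
    show "d_return_set N f (U0 \<inter> (g ^^ k) -` V0) W
        \<subseteq> d_return_set N f U0 U \<inter> d_return_set N f V0 V"
    proof
      fix m assume "m \<in> d_return_set N f (U0 \<inter> (g ^^ k) -` V0) W"
      then obtain x where x: "x \<in> U0" "(g ^^ k) x \<in> V0"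
        and W: "\<forall>i\<in>{1..N}. (f i ^^ m) x \<in> U i \<and> (g ^^ k) ((f i ^^ m) x) \<in> V i"
        unfolding d_return_set_def W_def by blast
      \<comment> \<open>While \<open>x\<close> witnesses the return \<open>m\<close> for
        \<open>U0\<close> and \<open>U\<close>, its image \<open>(g ^^ k) x\<close> witnesses it for
        \<open>V0\<close> and \<open>V\<close>, by commutation.\<close>
      have "(f i ^^ m) ((g ^^ k) x) \<in> V i" if "i \<in> {1..N}" for i
        using bspec[OF W that] comm that by (simp add: funpow_commute)
      then show "m \<in> d_return_set N f U0 U \<inter> d_return_set N f V0 V"
        using x W unfolding d_return_set_def by blast
    qed
  qed
qed

theorem theorem3p7:
  fixes f :: "nat \<Rightarrow> 'z::{t2_space, perfect_space} \<Rightarrow> 'z" and N :: nat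
  assumes "N \<ge> 1"
    and "\<And>i. i \<in> {1..N} \<Longrightarrow> continuous_on UNIV (f i)"
    and "d_transitive N f"
    and "\<exists>g. weakly_mixing g \<and> (\<forall>i\<in>{1..N}. g \<circ> f i = f i \<circ> g)"
  shows "filter_family (d_return_family N f)"
proof -
  obtain g where g: "weakly_mixing g" "\<forall>i\<in>{1..N}. g \<circ> f i = f i \<circ> g"
    using assms(4) by blast
  have "continuous_on UNIV (f 1)"
    using assms(1,2) by simp
  from d_return_set_infinite[OF assms(1) this assms(3)]
  have "infinite A" if "A \<in> d_return_family N f" for A
    using that infinite_super unfolding d_return_family_def by blast
  moreover have "B \<in> d_return_family N f" if "A \<in> d_return_family N f" "A \<subseteq> B" for A B
    using that unfolding d_return_family_def by blast
  moreover have "A \<inter> B \<in> d_return_family N f"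
    if A: "A \<in> d_return_family N f" and B: "B \<in> d_return_family N f" for A B
  proof -
    obtain U0 U where U: "open U0" "U0 \<noteq> {}" "\<forall>i\<in>{1..N}. open (U i) \<and> U i \<noteq> {}"
      and UA: "d_return_set N f U0 U \<subseteq> A"
      using A unfolding d_return_family_def by blast
    obtain V0 V where V: "open V0" "V0 \<noteq> {}" "\<forall>i\<in>{1..N}. open (V i) \<and> V i \<noteq> {}"
      and VB: "d_return_set N f V0 V \<subseteq> B"
      using B unfolding d_return_family_def by blast
    from d_return_set_Int[OF g U V] obtain W0 W where
      "open W0" "W0 \<noteq> {}" "\<forall>i\<in>{1..N}. open (W i) \<and> W i \<noteq> {}"
      "d_return_set N f W0 W \<subseteq> d_return_set N f U0 U \<inter> d_return_set N f V0 V" by blast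
    then show ?thesis
      using UA VB unfolding d_return_family_def by blast
  qed
  ultimately show ?thesis
    unfolding filter_family_def furstenberg_family_def by blast
qed

end
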